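(* Let $M^2_1$ be a Lorentz surface of general type in $\mathbb{E}^4_2$ with geometric functions $\nu_1,\nu_2$. Then $M^2_1$ is of flat normal connection if and only if $\nu_1+\nu_2=0$.
   Context: $\mathbb{E}^4_2$ is $\mathbb{R}^4$ with the standard orientation and the metric $\langle\cdot,\cdot\rangle=dx_1^2+dx_2^2-dx_3^2-dx_4^2$; $\nabla'$ is its Levi-Civita connection. A Lorentz surface $M^2_1:z=z(u,v)$, $(u,v)$ in a domain of $\mathbb{R}^2$, is a smooth immersed surface whose induced metric has signature $(1,1)$. $\sigma$ is its second fundamental form (normal part of $\nabla'_XY$), $D$ its normal connection (normal part of $\nabla'_X\xi$ for normal $\xi$), and $H=\frac12\operatorname{tr}\sigma=\frac12(\sigma(x,x)-\sigma(y,y))$ for tangent orthonormal $x,y$ with $\langle x,x\rangle=1$, $\langle y,y\rangle=-1$. Write $E=\langle z_u,z_u\rangle>0$, $F=\langle z_u,z_v\rangle$, $G=\langle z_v,z_v\rangle<0$ (parameters are always taken with these signs), $W=\sqrt{|EG-F^2|}$. For a normal frame $n_1,n_2$ with $\langle n_1,n_1\rangle=1$, $\langle n_2,n_2\rangle=-1$, $\langle n_1,n_2\rangle=0$ put $c_{11}^k=\langle z_{uu},n_k\rangle$, $c_{12}^k=\langle z_{uv},n_k\rangle$, $c_{22}^k=\langle z_{vv},n_k\rangle$, $\Delta_1=c_{11}^1c_{12}^2-c_{12}^1c_{11}^2$, $\Delta_2=c_{11}^1c_{22}^2-c_{22}^1c_{11}^2$, $\Delta_3=c_{12}^1c_{22}^2-c_{22}^1c_{12}^2$,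 $L=2\Delta_1/W$, $M=\Delta_2/W$, $N=2\Delta_3/W$, $k=\frac{LN-M^2}{EG-F^2}$, $\varkappa=\frac{EN+GL-2FM}{2(EG-F^2)}$. A Lorentz surface of general type is one that is free of flat points, i.e. $(L,M,N)\ne(0,0,0)$ everywhere, satisfies $\varkappa^2-k>0$ everywhere, and whose mean curvature vector $H$ is at each point non-zero and either spacelike ($\langle H,H\rangle>0$) or timelike ($\langle H,H\rangle<0$). Set $\varepsilon=\operatorname{sign}\langle H,H\rangle$. Parameters are principal if $F=0$ and $M=0$; since $\varkappa^2-k>0$, the surface is assumed parametrized by principal parameters. Put $x=z_u/\sqrt{E}$, $y=z_v/\sqrt{-G}$, $b=\varepsilon H/\sqrt{\varepsilon\langle H,H\rangle}$ (so $\langle b,b\rangle=\varepsilon$). The geometric functions $\nu_1,\nu_2$ are $\nu_1=\langle\sigma(x,x),b\rangle$, $\nu_2=\langle\sigma(y,y),b\rangle$. The surface is of flat normal connection if the curvature tensor $R^\perp(X,Y)n=D_XD_Yn-D_YD_Xn-D_{[X,Y]}n$ of $D$ vanishes identically; the curvature of the normal connection is $\langle R^\perp(x,y)n_2,n_1\rangle$ for a positively oriented orthonormal quadruple $\{x,y,n_1,n_2\}$ with $x,n_1$ spacelike and $y,n_2$ timelike. *)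

theory Defs
  imports "HOL-Analysis.Analysis"
begin

section \<open>Smooth maps\<close>

text \<open>
  For an open set S of a Euclidean space, C^k regularity in the sense that all iterated
  directional derivatives up to order k exist and are continuous on S.
\<close>

primrec times_differentiable_on ::
  "nat \<Rightarrow> 'a::real_normed_vector set \<Rightarrow> ('a \<Rightarrow> 'b::real_normed_vector) \<Rightarrow> bool" where
  "times_differentiable_on 0 S f \<longleftrightarrow> continuous_on S f"
| "times_differentiable_on (Suc k) S f \<longleftrightarrow>
     (\<forall>p\<in>S. f differentiable (at p)) \<and>
     (\<forall>w. times_differentiable_on k S (\<lambda>p. frechet_derivative f (at p) w))"

definition smooth_on :: "'a::real_normed_vector set \<Rightarrow> ('a \<Rightarrow> 'b::real_normed_vector) \<Rightarrow> bool" where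
  "smooth_on S f \<longleftrightarrow> (\<forall>k. times_differentiable_on k S f)"

section \<open>The space of signature (2,2) and Lorentz surfaces in it\<close>

definition ip22 :: "real ^ 4 \<Rightarrow> real ^ 4 \<Rightarrow> real" where
  "ip22 a b = a $ 1 * b $ 1 + a $ 2 * b $ 2 - a $ 3 * b $ 3 - a $ 4 * b $ 4"

text \<open>
  A surface is a map z from a domain U of the parameter plane.  Tangent vectors and tangent
  vector fields of the surface are given by their coordinates in the parameter plane; dz z p a
  is the corresponding vector of the ambient space.  Vector fields along the surface are
  functions of the parameters with values in the ambient space.
\<close>

type_synonym param = "real \<times> real"

definition dz :: "(param \<Rightarrow> real ^ 4) \<Rightarrow> param \<Rightarrow> param \<Rightarrow> real ^ 4" where
  "dz z p a = frechet_derivative z (at p) a"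

definition first_ff :: "(param \<Rightarrow> real ^ 4) \<Rightarrow> param \<Rightarrow> param \<Rightarrow> param \<Rightarrow> real" where
  "first_ff z p a b = ip22 (dz z p a) (dz z p b)"

definition tangent_orthonormal :: "(param \<Rightarrow> real ^ 4) \<Rightarrow> param \<Rightarrow> param \<Rightarrow> param \<Rightarrow> bool" where
  "tangent_orthonormal z p a b \<longleftrightarrow>
     first_ff z p a a = 1 \<and> first_ff z p b b = -1 \<and> first_ff z p a b = 0"

text \<open>
  Signature (1,1) of the induced metric is expressed by an orthonormal basis consisting of one
  spacelike and one timelike vector; such a pair is automatically linearly independent.
\<close>

definition lorentz_surface :: "param set \<Rightarrow> (param \<Rightarrow> real ^ 4) \<Rightarrow> bool" where
  "lorentz_surface U z \<longleftrightarrow>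
     open U \<and> connected U \<and> smooth_on U z \<and>
     (\<forall>p\<in>U. inj (dz z p)) \<and>
     (\<forall>p\<in>U. \<exists>a b. tangent_orthonormal z p a b)"

definition tangent_space :: "(param \<Rightarrow> real ^ 4) \<Rightarrow> param \<Rightarrow> (real ^ 4) set" where
  "tangent_space z p = range (dz z p)"

definition normal_space :: "(param \<Rightarrow> real ^ 4) \<Rightarrow> param \<Rightarrow> (real ^ 4) set" where
  "normal_space z p = {w. \<forall>t\<in>tangent_space z p. ip22 w t = 0}"

text \<open>Well defined because the induced metric is non-degenerate.\<close>

definition normal_part :: "(param \<Rightarrow> real ^ 4) \<Rightarrow> param \<Rightarrow> real ^ 4 \<Rightarrow> real ^ 4" where
  "normal_part z p w = (THE n. n \<in> normal_space z p \<and> w - n \<in> tangent_space z p)"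

section \<open>Second fundamental form, mean curvature and normal connection\<close>

text \<open>
  The metric has constant coefficients in the standard coordinates, so its Levi-Civita
  connection is componentwise differentiation.
\<close>

definition nabla' :: "(param \<Rightarrow> param) \<Rightarrow> (param \<Rightarrow> real ^ 4) \<Rightarrow> param \<Rightarrow> real ^ 4" where
  "nabla' X Z p = frechet_derivative Z (at p) (X p)"

definition second_ff ::
  "(param \<Rightarrow> real ^ 4) \<Rightarrow> (param \<Rightarrow> param) \<Rightarrow> (param \<Rightarrow> param) \<Rightarrow> param \<Rightarrow> real ^ 4" where
  "second_ff z X Y p = normal_part z p (nabla' X (\<lambda>q. dz z q (Y q)) p)"

text \<open>
  The value is independent of the choice of the tangent fields X, Y orthonormal at p, since
  the second fundamental form is tensorial and the trace is independent of the basis.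
\<close>

definition mean_curvature :: "param set \<Rightarrow> (param \<Rightarrow> real ^ 4) \<Rightarrow> param \<Rightarrow> real ^ 4" where
  "mean_curvature U z p =
     (THE h. \<forall>X Y. smooth_on U X \<and> smooth_on U Y \<and> tangent_orthonormal z p (X p) (Y p) \<longrightarrow>
        h = (1/2) *\<^sub>R (second_ff z X X p - second_ff z Y Y p))"

definition normal_field :: "param set \<Rightarrow> (param \<Rightarrow> real ^ 4) \<Rightarrow> (param \<Rightarrow> real ^ 4) \<Rightarrow> bool" where
  "normal_field U z \<xi> \<longleftrightarrow> smooth_on U \<xi> \<and> (\<forall>p\<in>U. \<xi> p \<in> normal_space z p)"

definition normal_conn ::
  "(param \<Rightarrow> real ^ 4) \<Rightarrow> (param \<Rightarrow> param) \<Rightarrow> (param \<Rightarrow> real ^ 4) \<Rightarrow> param \<Rightarrow> real ^ 4" where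
  "normal_conn z X \<xi> p = normal_part z p (nabla' X \<xi> p)"

definition lie_bracket :: "(param \<Rightarrow> param) \<Rightarrow> (param \<Rightarrow> param) \<Rightarrow> param \<Rightarrow> param" where
  "lie_bracket X Y p = frechet_derivative Y (at p) (X p) - frechet_derivative X (at p) (Y p)"

definition normal_curvature_tensor ::
  "(param \<Rightarrow> real ^ 4) \<Rightarrow> (param \<Rightarrow> param) \<Rightarrow> (param \<Rightarrow> param) \<Rightarrow> (param \<Rightarrow> real ^ 4) \<Rightarrow>
   param \<Rightarrow> real ^ 4" where
  "normal_curvature_tensor z X Y \<xi> p =
     normal_conn z X (normal_conn z Y \<xi>) p - normal_conn z Y (normal_conn z X \<xi>) p
     - normal_conn z (lie_bracket X Y) \<xi> p"

definition flat_normal_connection :: "param set \<Rightarrow> (param \<Rightarrow> real ^ 4) \<Rightarrow> bool" where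
  "flat_normal_connection U z \<longleftrightarrow>
     (\<forall>X Y \<xi>. smooth_on U X \<and> smooth_on U Y \<and> normal_field U z \<xi> \<longrightarrow>
        (\<forall>p\<in>U. normal_curvature_tensor z X Y \<xi> p = 0))"

section \<open>Coefficients and invariants\<close>

definition d_u :: "(param \<Rightarrow> real ^ 4) \<Rightarrow> param \<Rightarrow> real ^ 4" where
  "d_u f p = frechet_derivative f (at p) (1, 0)"

definition d_v :: "(param \<Rightarrow> real ^ 4) \<Rightarrow> param \<Rightarrow> real ^ 4" where
  "d_v f p = frechet_derivative f (at p) (0, 1)"

definition coef_E :: "(param \<Rightarrow> real ^ 4) \<Rightarrow> param \<Rightarrow> real" where
  "coef_E z p = ip22 (d_u z p) (d_u z p)"

definition coef_F :: "(param \<Rightarrow> real ^ 4) \<Rightarrow> param \<Rightarrow> real" where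
  "coef_F z p = ip22 (d_u z p) (d_v z p)"

definition coef_G :: "(param \<Rightarrow> real ^ 4) \<Rightarrow> param \<Rightarrow> real" where
  "coef_G z p = ip22 (d_v z p) (d_v z p)"

definition coef_W :: "(param \<Rightarrow> real ^ 4) \<Rightarrow> param \<Rightarrow> real" where
  "coef_W z p = sqrt \<bar>coef_E z p * coef_G z p - (coef_F z p)\<^sup>2\<bar>"

definition normal_frame ::
  "param set \<Rightarrow> (param \<Rightarrow> real ^ 4) \<Rightarrow> (param \<Rightarrow> real ^ 4) \<Rightarrow> (param \<Rightarrow> real ^ 4) \<Rightarrow> bool" where
  "normal_frame U z n1 n2 \<longleftrightarrow>
     (\<forall>p\<in>U. n1 p \<in> normal_space z p \<and> n2 p \<in> normal_space z p \<and>
        ip22 (n1 p) (n1 p) = 1 \<and> ip22 (n2 p) (n2 p) = -1 \<and> ip22 (n1 p) (n2 p) = 0)"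

definition c11 :: "(param \<Rightarrow> real ^ 4) \<Rightarrow> (param \<Rightarrow> real ^ 4) \<Rightarrow> param \<Rightarrow> real" where
  "c11 z n p = ip22 (d_u (d_u z) p) (n p)"

text \<open>Here z_uv denotes the v-derivative of z_u.\<close>

definition c12 :: "(param \<Rightarrow> real ^ 4) \<Rightarrow> (param \<Rightarrow> real ^ 4) \<Rightarrow> param \<Rightarrow> real" where
  "c12 z n p = ip22 (d_v (d_u z) p) (n p)"

definition c22 :: "(param \<Rightarrow> real ^ 4) \<Rightarrow> (param \<Rightarrow> real ^ 4) \<Rightarrow> param \<Rightarrow> real" where
  "c22 z n p = ip22 (d_v (d_v z) p) (n p)"

definition Delta1 ::
  "(param \<Rightarrow> real ^ 4) \<Rightarrow> (param \<Rightarrow> real ^ 4) \<Rightarrow> (param \<Rightarrow> real ^ 4) \<Rightarrow> param \<Rightarrow> real" where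
  "Delta1 z n1 n2 p = c11 z n1 p * c12 z n2 p - c12 z n1 p * c11 z n2 p"

definition Delta2 ::
  "(param \<Rightarrow> real ^ 4) \<Rightarrow> (param \<Rightarrow> real ^ 4) \<Rightarrow> (param \<Rightarrow> real ^ 4) \<Rightarrow> param \<Rightarrow> real" where
  "Delta2 z n1 n2 p = c11 z n1 p * c22 z n2 p - c22 z n1 p * c11 z n2 p"

definition Delta3 ::
  "(param \<Rightarrow> real ^ 4) \<Rightarrow> (param \<Rightarrow> real ^ 4) \<Rightarrow> (param \<Rightarrow> real ^ 4) \<Rightarrow> param \<Rightarrow> real" where
  "Delta3 z n1 n2 p = c12 z n1 p * c22 z n2 p - c22 z n1 p * c12 z n2 p"

definition coef_L ::
  "(param \<Rightarrow> real ^ 4) \<Rightarrow> (param \<Rightarrow> real ^ 4) \<Rightarrow> (param \<Rightarrow> real ^ 4) \<Rightarrow> param \<Rightarrow> real" where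
  "coef_L z n1 n2 p = 2 * Delta1 z n1 n2 p / coef_W z p"

definition coef_M ::
  "(param \<Rightarrow> real ^ 4) \<Rightarrow> (param \<Rightarrow> real ^ 4) \<Rightarrow> (param \<Rightarrow> real ^ 4) \<Rightarrow> param \<Rightarrow> real" where
  "coef_M z n1 n2 p = Delta2 z n1 n2 p / coef_W z p"

definition coef_N ::
  "(param \<Rightarrow> real ^ 4) \<Rightarrow> (param \<Rightarrow> real ^ 4) \<Rightarrow> (param \<Rightarrow> real ^ 4) \<Rightarrow> param \<Rightarrow> real" where
  "coef_N z n1 n2 p = 2 * Delta3 z n1 n2 p / coef_W z p"

definition inv_k ::
  "(param \<Rightarrow> real ^ 4) \<Rightarrow> (param \<Rightarrow> real ^ 4) \<Rightarrow> (param \<Rightarrow> real ^ 4) \<Rightarrow> param \<Rightarrow> real" where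
  "inv_k z n1 n2 p =
     (coef_L z n1 n2 p * coef_N z n1 n2 p - (coef_M z n1 n2 p)\<^sup>2) /
     (coef_E z p * coef_G z p - (coef_F z p)\<^sup>2)"

definition inv_kappa ::
  "(param \<Rightarrow> real ^ 4) \<Rightarrow> (param \<Rightarrow> real ^ 4) \<Rightarrow> (param \<Rightarrow> real ^ 4) \<Rightarrow> param \<Rightarrow> real" where
  "inv_kappa z n1 n2 p =
     (coef_E z p * coef_N z n1 n2 p + coef_G z p * coef_L z n1 n2 p
        - 2 * coef_F z p * coef_M z n1 n2 p) /
     (2 * (coef_E z p * coef_G z p - (coef_F z p)\<^sup>2))"

section \<open>Surfaces of general type and their geometric functions\<close>

text \<open>
  A change of the normal frame multiplies L, M, N simultaneously by a sign, so the
  conditions below do not depend on the frame, and smoothness of the frame is irrelevant.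
\<close>

definition general_type ::
  "param set \<Rightarrow> (param \<Rightarrow> real ^ 4) \<Rightarrow> (param \<Rightarrow> real ^ 4) \<Rightarrow> (param \<Rightarrow> real ^ 4) \<Rightarrow> bool" where
  "general_type U z n1 n2 \<longleftrightarrow>
     (\<forall>p\<in>U.
        (coef_L z n1 n2 p, coef_M z n1 n2 p, coef_N z n1 n2 p) \<noteq> (0, 0, 0) \<and>
        (inv_kappa z n1 n2 p)\<^sup>2 - inv_k z n1 n2 p > 0 \<and>
        mean_curvature U z p \<noteq> 0 \<and>
        (ip22 (mean_curvature U z p) (mean_curvature U z p) > 0 \<or>
         ip22 (mean_curvature U z p) (mean_curvature U z p) < 0))"

definition principal_parameters ::
  "param set \<Rightarrow> (param \<Rightarrow> real ^ 4) \<Rightarrow> (param \<Rightarrow> real ^ 4) \<Rightarrow> (param \<Rightarrow> real ^ 4) \<Rightarrow> bool" where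
  "principal_parameters U z n1 n2 \<longleftrightarrow> (\<forall>p\<in>U. coef_F z p = 0 \<and> coef_M z n1 n2 p = 0)"

definition eps :: "param set \<Rightarrow> (param \<Rightarrow> real ^ 4) \<Rightarrow> param \<Rightarrow> real" where
  "eps U z p = sgn (ip22 (mean_curvature U z p) (mean_curvature U z p))"

definition b_field :: "param set \<Rightarrow> (param \<Rightarrow> real ^ 4) \<Rightarrow> param \<Rightarrow> real ^ 4" where
  "b_field U z p =
     (eps U z p / sqrt (eps U z p * ip22 (mean_curvature U z p) (mean_curvature U z p)))
       *\<^sub>R mean_curvature U z p"

text \<open>Parameter-plane coordinates of z_u / sqrt E and z_v / sqrt (-G).\<close>

definition x_field :: "(param \<Rightarrow> real ^ 4) \<Rightarrow> param \<Rightarrow> param" where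
  "x_field z p = (1 / sqrt (coef_E z p), 0)"

definition y_field :: "(param \<Rightarrow> real ^ 4) \<Rightarrow> param \<Rightarrow> param" where
  "y_field z p = (0, 1 / sqrt (- coef_G z p))"

definition nu1 :: "param set \<Rightarrow> (param \<Rightarrow> real ^ 4) \<Rightarrow> param \<Rightarrow> real" where
  "nu1 U z p = ip22 (second_ff z (x_field z) (x_field z) p) (b_field U z p)"

definition nu2 :: "param set \<Rightarrow> (param \<Rightarrow> real ^ 4) \<Rightarrow> param \<Rightarrow> real" where
  "nu2 U z p = ip22 (second_ff z (y_field z) (y_field z) p) (b_field U z p)"

end

theory Submission
  imports Defs
begin

text \<open>
  The theorem is an algebraic consequence of the Ricci equation.  At a point write
  \<open>A\<close>, \<open>B\<close>, \<open>C\<close> for the values of the second fundamental form on the pairs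
  \<open>(\<partial>u, \<partial>u)\<close>, \<open>(\<partial>u, \<partial>v)\<close>, \<open>(\<partial>v, \<partial>v)\<close>, and put \<open>S = A / E - C / G\<close>.  Since
  \<open>F = 0\<close>, this is \<open>\<sigma>(x,x) + \<sigma>(y,y)\<close>, whereas \<open>2 H = A / E + C / G\<close>.

  The ambient space is flat, so the normal curvature of a normal field \<open>\<xi>\<close> is
  \<open>\<sigma>(X, A\<^sub>\<xi> Y) - \<sigma>(Y, A\<^sub>\<xi> X)\<close> with the shape operator \<open>A\<^sub>\<xi>\<close> (lemma \<open>ricci_equation\<close>).
  Expanded in the coordinate basis, this is the determinant of \<open>(X, Y)\<close> times
  \<open>\<langle>\<xi>, B\<rangle> S - \<langle>\<xi>, S\<rangle> B\<close> (lemma \<open>normal_curvature_tensor_eq\<close>).  Hence the normal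
  connection is flat exactly when \<open>S\<close> and \<open>B\<close> are linearly dependent everywhere.

  The condition \<open>M = 0\<close> says that \<open>A\<close> and \<open>C\<close> are linearly dependent.  As \<open>H\<close> is a
  combination of the two with \<open>\<langle>H, H\<rangle> \<noteq> 0\<close>, all of \<open>A\<close>, \<open>C\<close> and \<open>S\<close> are multiples of \<open>H\<close>, so
  \<open>\<nu>\<^sub>1 + \<nu>\<^sub>2 = \<langle>S, b\<rangle>\<close> vanishes if and only if \<open>S = 0\<close>.  If \<open>S = 0\<close>, the connection is flat.
  If the connection is flat and \<open>S \<noteq> 0\<close> at some point, then \<open>B\<close> is also a multiple of \<open>H\<close>
  there, so that \<open>L = M = N = 0\<close> and the point is flat, which a surface of general type
  excludes.
\<close>

section \<open>Calculus of smooth maps\<close>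

text \<open>
  The iterated derivatives at a point of an open set only depend on the germ of the map.  This
  makes it possible to replace a map by an explicit formula that is valid on the set alone.
\<close>
lemma times_differentiable_on_cong:
  assumes "open S" and "times_differentiable_on k S f" and "\<And>p. p \<in> S \<Longrightarrow> f p = g p"
  shows "times_differentiable_on k S g"
  using assms(2,3)
proof (induction k arbitrary: f g)
  case 0
  then show ?case by (simp cong: continuous_on_cong)
next
  case (Suc k)
  have D: "(g has_derivative frechet_derivative f (at p)) (at p)" if "p \<in> S" for p
  proof (rule has_derivative_transform_within_open[OF _ \<open>open S\<close> that])
    show "(f has_derivative frechet_derivative f (at p)) (at p)"
      using Suc.prems(1) that by (simp add: frechet_derivative_works)
  qed (rule Suc.prems(2))
  show ?case
    unfolding times_differentiable_on.simps
  proof (intro conjI ballI allI)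
    show "g differentiable (at p)" if "p \<in> S" for p
      using D[OF that] by (auto simp: differentiable_def)
    show "times_differentiable_on k S (\<lambda>p. frechet_derivative g (at p) w)" for w
    proof (rule Suc.IH)
      show "times_differentiable_on k S (\<lambda>p. frechet_derivative f (at p) w)"
        using Suc.prems(1) by simp
      show "frechet_derivative f (at p) w = frechet_derivative g (at p) w" if "p \<in> S" for p
        using frechet_derivative_at[OF D[OF that]] by simp
    qed
  qed
qed

lemma times_differentiable_on_Suc_imp:
  "times_differentiable_on (Suc k) S f \<Longrightarrow> times_differentiable_on k S f"
proof (induction k arbitrary: f)
  case 0
  then show ?case
    by (auto intro!: continuous_at_imp_continuous_on differentiable_imp_continuous_within)
next
  case (Suc k)
  then show ?case by (metis times_differentiable_on.simps(2))
qed

lemma times_differentiable_on_const: "times_differentiable_on k S (\<lambda>p. c)"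
  by (induction k arbitrary: c) auto

lemma times_differentiable_on_add:
  assumes "open S"
  shows "times_differentiable_on k S f \<Longrightarrow> times_differentiable_on k S g \<Longrightarrow>
    times_differentiable_on k S (\<lambda>p. f p + g p)"
proof (induction k arbitrary: f g)
  case 0
  then show ?case by (simp add: continuous_on_add)
next
  case (Suc k)
  have D: "((\<lambda>q. f q + g q) has_derivative
      (\<lambda>w. frechet_derivative f (at p) w + frechet_derivative g (at p) w)) (at p)"
    if "p \<in> S" for p
    using Suc.prems that by (intro has_derivative_add) (simp_all add: frechet_derivative_works)
  show ?case
    unfolding times_differentiable_on.simps
  proof (intro conjI ballI allI)
    show "(\<lambda>q. f q + g q) differentiable (at p)" if "p \<in> S" for p
      using D[OF that] by (auto simp: differentiable_def)
    show "times_differentiable_on k S (\<lambda>p. frechet_derivative (\<lambda>q. f q + g q) (at p) w)" for w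
    proof (rule times_differentiable_on_cong[OF \<open>open S\<close>])
      show "times_differentiable_on k S
          (\<lambda>p. frechet_derivative f (at p) w + frechet_derivative g (at p) w)"
        using Suc.prems by (intro Suc.IH) simp_all
    next
      fix p assume "p \<in> S"
      from frechet_derivative_at[OF D[OF this]]
      show "frechet_derivative f (at p) w + frechet_derivative g (at p) w =
          frechet_derivative (\<lambda>q. f q + g q) (at p) w"
        by metis
    qed
  qed
qed

text \<open>
  The product rule expresses a derivative of the product through products of maps of one order of
  regularity less, so that induction on the order applies to arbitrary factors.
\<close>
lemma times_differentiable_on_bilinear:
  assumes "open S" and "bounded_bilinear B"
  shows "times_differentiable_on k S f \<Longrightarrow> times_differentiable_on k S g \<Longrightarrow>
    times_differentiable_on k S (\<lambda>p. B (f p) (g p))"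
proof (induction k arbitrary: f g)
  case 0
  then show ?case by (simp add: bounded_bilinear.continuous_on[OF assms(2)])
next
  case (Suc k)
  have D: "((\<lambda>q. B (f q) (g q)) has_derivative
      (\<lambda>w. B (f p) (frechet_derivative g (at p) w) + B (frechet_derivative f (at p) w) (g p)))
      (at p)" if "p \<in> S" for p
    using Suc.prems that
    by (intro bounded_bilinear.FDERIV[OF assms(2)]) (simp_all add: frechet_derivative_works)
  show ?case
    unfolding times_differentiable_on.simps
  proof (intro conjI ballI allI)
    show "(\<lambda>q. B (f q) (g q)) differentiable (at p)" if "p \<in> S" for p
      using D[OF that] by (auto simp: differentiable_def)
    show "times_differentiable_on k S
        (\<lambda>p. frechet_derivative (\<lambda>q. B (f q) (g q)) (at p) w)" for w
    proof (rule times_differentiable_on_cong[OF \<open>open S\<close>])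
      show "times_differentiable_on k S (\<lambda>p. B (f p) (frechet_derivative g (at p) w) +
          B (frechet_derivative f (at p) w) (g p))"
        using Suc.prems times_differentiable_on_Suc_imp[OF Suc.prems(1)]
          times_differentiable_on_Suc_imp[OF Suc.prems(2)]
        by (intro times_differentiable_on_add[OF \<open>open S\<close>] Suc.IH) simp_all
    next
      fix p assume "p \<in> S"
      from frechet_derivative_at[OF D[OF this]]
      show "B (f p) (frechet_derivative g (at p) w) + B (frechet_derivative f (at p) w) (g p) =
          frechet_derivative (\<lambda>q. B (f q) (g q)) (at p) w"
        by metis
    qed
  qed
qed

lemma smooth_on_const: "smooth_on S (\<lambda>p. c)"
  by (simp add: smooth_on_def times_differentiable_on_const)

lemma smooth_on_bilinear:
  "open S \<Longrightarrow> bounded_bilinear B \<Longrightarrow> smooth_on S f \<Longrightarrow> smooth_on S g \<Longrightarrow>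
    smooth_on S (\<lambda>p. B (f p) (g p))"
  by (simp add: smooth_on_def times_differentiable_on_bilinear)

lemma smooth_on_scaleR:
  "open S \<Longrightarrow> smooth_on S f \<Longrightarrow> smooth_on S g \<Longrightarrow> smooth_on S (\<lambda>p. f p *\<^sub>R g p)"
  by (rule smooth_on_bilinear[OF _ bounded_bilinear_scaleR])

lemma smooth_on_add:
  "open S \<Longrightarrow> smooth_on S f \<Longrightarrow> smooth_on S g \<Longrightarrow> smooth_on S (\<lambda>p. f p + g p)"
  by (simp add: smooth_on_def times_differentiable_on_add)

lemma smooth_on_diff:
  assumes "open S" and "smooth_on S f" and "smooth_on S g"
  shows "smooth_on S (\<lambda>p. f p - g p)"
proof -
  have "smooth_on S (\<lambda>p. (-1) *\<^sub>R g p)"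
    using assms by (intro smooth_on_scaleR smooth_on_const)
  then have "smooth_on S (\<lambda>p. f p + (-1) *\<^sub>R g p)"
    by (rule smooth_on_add[OF assms(1,2)])
  then show ?thesis by simp
qed

lemma smooth_on_imp_differentiable:
  "smooth_on S f \<Longrightarrow> p \<in> S \<Longrightarrow> f differentiable (at p)"
  unfolding smooth_on_def by (metis times_differentiable_on.simps(2))

lemma smooth_on_frechet_derivative:
  "smooth_on S f \<Longrightarrow> smooth_on S (\<lambda>p. frechet_derivative f (at p) w)"
  unfolding smooth_on_def by (metis times_differentiable_on.simps(2))

lemma smooth_on_imp_continuous_on: "smooth_on S f \<Longrightarrow> continuous_on S f"
  unfolding smooth_on_def by (metis times_differentiable_on.simps(1))

section \<open>Symmetry of second derivatives\<close>

definition hess :: "('a::real_normed_vector \<Rightarrow> 'b::real_normed_vector) \<Rightarrow> 'a \<Rightarrow> 'a \<Rightarrow> 'a \<Rightarrow> 'b" where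
  "hess f p a b = frechet_derivative (\<lambda>q. frechet_derivative f (at q) b) (at p) a"

text \<open>
  Two applications of the mean value theorem, the first to the difference of \<open>f\<close> along two
  parallel segments in direction \<open>a\<close>, the second to the derivative of \<open>f\<close> in direction \<open>a\<close>
  along a segment in direction \<open>b\<close>.
\<close>
lemma second_difference_mean_value:
  fixes f :: "'a::real_normed_vector \<Rightarrow> real"
  assumes f: "\<And>q. q \<in> ball p r \<Longrightarrow> f differentiable (at q)"
    and fa: "\<And>q. q \<in> ball p r \<Longrightarrow> (\<lambda>q. frechet_derivative f (at q) a) differentiable (at q)"
    and s: "0 < s" "s * (norm a + norm b) < r"
  shows "\<exists>q\<in>ball p r. f (p + s *\<^sub>R a + s *\<^sub>R b) - f (p + s *\<^sub>R a) - f (p + s *\<^sub>R b) + f p =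
    s * s * hess f q b a"
proof -
  have in_ball: "p + t *\<^sub>R a + t' *\<^sub>R b \<in> ball p r" if "0 \<le> t" "t \<le> s" "0 \<le> t'" "t' \<le> s" for t t'
  proof -
    have "norm (t *\<^sub>R a + t' *\<^sub>R b) \<le> t * norm a + t' * norm b"
      using norm_triangle_ineq[of "t *\<^sub>R a" "t' *\<^sub>R b"] that by simp
    also have "\<dots> \<le> s * norm a + s * norm b"
      using that by (intro add_mono mult_right_mono) auto
    also have "\<dots> < r" using s(2) by (simp add: algebra_simps)
    finally show ?thesis
      by (simp add: dist_norm add.assoc flip: norm_minus_cancel[of "t *\<^sub>R a + t' *\<^sub>R b"])
  qed
  let ?Da = "\<lambda>q. frechet_derivative f (at q) a"
  have line: "((\<lambda>t. g (c + t *\<^sub>R d)) has_real_derivative frechet_derivative g (at (c + t *\<^sub>R d)) d) (at t)"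
    if "g differentiable (at (c + t *\<^sub>R d))" for g :: "'a \<Rightarrow> real" and c d t
  proof -
    have "(g has_derivative frechet_derivative g (at (c + t *\<^sub>R d))) (at (c + t *\<^sub>R d))"
      using that by (simp add: frechet_derivative_works)
    moreover have "((\<lambda>t. c + t *\<^sub>R d) has_derivative (\<lambda>h. h *\<^sub>R d)) (at t)"
      by (auto intro!: derivative_eq_intros)
    ultimately have "((\<lambda>t. g (c + t *\<^sub>R d)) has_derivative
        (\<lambda>h. frechet_derivative g (at (c + t *\<^sub>R d)) (h *\<^sub>R d))) (at t)"
      using has_derivative_compose by fastforce
    then show ?thesis
      using linear_frechet_derivative[OF that]
      by (simp add: has_field_derivative_def linear_scale mult.commute[of _ "frechet_derivative _ _ _"] )
  qed
  \<comment> \<open>the increment of \<open>f\<close> in direction \<open>b\<close>, as a function of the position in direction \<open>a\<close>\<close>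
  define \<phi> where "\<phi> t = f ((p + s *\<^sub>R b) + t *\<^sub>R a) - f (p + t *\<^sub>R a)" for t
  have "\<exists>\<xi>. 0 < \<xi> \<and> \<xi> < s \<and> \<phi> s - \<phi> 0 = (s - 0) * (?Da ((p + s *\<^sub>R b) + \<xi> *\<^sub>R a) - ?Da (p + \<xi> *\<^sub>R a))"
  proof (rule MVT2[OF s(1)])
    fix t assume t: "0 \<le> t" "t \<le> s"
    show "(\<phi> has_real_derivative ?Da ((p + s *\<^sub>R b) + t *\<^sub>R a) - ?Da (p + t *\<^sub>R a)) (at t)"
      unfolding \<phi>_def
      using in_ball[of t s] in_ball[of t 0] t s(1)
      by (intro DERIV_diff line f) (simp_all add: algebra_simps)
  qed
  then obtain \<xi> where \<xi>: "0 < \<xi>" "\<xi> < s"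
    and 1: "\<phi> s - \<phi> 0 = s * (?Da ((p + s *\<^sub>R b) + \<xi> *\<^sub>R a) - ?Da (p + \<xi> *\<^sub>R a))" by auto
  have "\<exists>\<eta>. 0 < \<eta> \<and> \<eta> < s \<and> ?Da ((p + \<xi> *\<^sub>R a) + s *\<^sub>R b) - ?Da ((p + \<xi> *\<^sub>R a) + 0 *\<^sub>R b) =
      (s - 0) * hess f ((p + \<xi> *\<^sub>R a) + \<eta> *\<^sub>R b) b a"
    unfolding hess_def
    using in_ball \<xi> by (intro MVT2[OF s(1)] line fa) auto
  then obtain \<eta> where \<eta>: "0 < \<eta>" "\<eta> < s"
    and 2: "?Da ((p + \<xi> *\<^sub>R a) + s *\<^sub>R b) - ?Da (p + \<xi> *\<^sub>R a) =
      s * hess f ((p + \<xi> *\<^sub>R a) + \<eta> *\<^sub>R b) b a" by auto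
  have "f (p + s *\<^sub>R a + s *\<^sub>R b) - f (p + s *\<^sub>R a) - f (p + s *\<^sub>R b) + f p = \<phi> s - \<phi> 0"
    by (simp add: \<phi>_def algebra_simps)
  also have "\<dots> = s * s * hess f (p + \<xi> *\<^sub>R a + \<eta> *\<^sub>R b) b a"
    using 1 2 by (simp add: algebra_simps)
  finally show ?thesis
    using in_ball[of \<xi> \<eta>] \<xi> \<eta> by (intro bexI[of _ "p + \<xi> *\<^sub>R a + \<eta> *\<^sub>R b"]) auto
qed

text \<open>
  The second difference of \<open>f\<close> is symmetric in \<open>a\<close> and \<open>b\<close>, so the mean value theorem computes it
  both as a value of the one mixed derivative and as a value of the other, at two points that are
  arbitrarily close to \<open>p\<close>.  Continuity of both mixed derivatives gives equality at \<open>p\<close>.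
\<close>
lemma hess_commute_real:
  fixes f :: "'a::real_normed_vector \<Rightarrow> real"
  assumes "open S" and "smooth_on S f" and "p \<in> S"
  shows "hess f p a b = hess f p b a"
proof -
  have smooth_D: "smooth_on S (\<lambda>q. frechet_derivative f (at q) w)" for w
    by (rule smooth_on_frechet_derivative[OF assms(2)])
  have cont: "continuous_on S (\<lambda>q. hess f q v w)" for v w
    unfolding hess_def
    by (intro smooth_on_imp_continuous_on smooth_on_frechet_derivative assms)
  have "\<bar>hess f p a b - hess f p b a\<bar> \<le> e" if "e > 0" for e
  proof -
    have near: "\<exists>r>0. \<forall>q\<in>ball p r. q \<in> S \<and> \<bar>hess f q v w - hess f p v w\<bar> < e / 2" for v w
    proof -
      have "continuous (at p) (\<lambda>q. hess f q v w)"
        using cont assms by (simp add: continuous_on_eq_continuous_at)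
      then obtain d where "d > 0" "\<And>q. dist q p < d \<Longrightarrow> dist (hess f q v w) (hess f p v w) < e / 2"
        using \<open>e > 0\<close> unfolding continuous_at_eps_delta by (meson half_gt_zero)
      moreover obtain d' where "d' > 0" "ball p d' \<subseteq> S"
        using assms by (meson openE)
      ultimately show ?thesis
        by (intro exI[of _ "min d d'"]) (auto simp: dist_commute dist_real_def)
    qed
    obtain r1 where r1: "r1 > 0" "\<And>q. q \<in> ball p r1 \<Longrightarrow> q \<in> S \<and> \<bar>hess f q a b - hess f p a b\<bar> < e / 2"
      using near by metis
    obtain r2 where r2: "r2 > 0" "\<And>q. q \<in> ball p r2 \<Longrightarrow> q \<in> S \<and> \<bar>hess f q b a - hess f p b a\<bar> < e / 2"
      using near by metis
    define r where "r = min r1 r2"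
    \<comment> \<open>the summand 1 keeps the denominator positive and the parallelogram strictly inside the ball\<close>
    define s where "s = r / (norm a + norm b + 1)"
    have pos: "norm a + norm b + 1 > 0" by (simp add: add_nonneg_pos)
    have r: "r > 0" using r1 r2 by (simp add: r_def)
    have s: "s > 0" using r pos by (simp add: s_def)
    have "s * (norm a + norm b + 1) = r" using pos by (simp add: s_def)
    then have sr: "s * (norm a + norm b) < r" "s * (norm b + norm a) < r"
      using s by (simp_all add: algebra_simps)
    have dif: "f differentiable (at q)" "(\<lambda>q. frechet_derivative f (at q) w) differentiable (at q)"
      if "q \<in> ball p r" for q w
      using that r1(2)[of q] smooth_on_imp_differentiable[OF assms(2)]
        smooth_on_imp_differentiable[OF smooth_D] by (auto simp: r_def)
    obtain q1 where q1: "q1 \<in> ball p r"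
      "f (p + s *\<^sub>R a + s *\<^sub>R b) - f (p + s *\<^sub>R a) - f (p + s *\<^sub>R b) + f p = s * s * hess f q1 b a"
      using second_difference_mean_value[of p r f a s b, OF dif s sr(1)] by auto
    obtain q2 where q2: "q2 \<in> ball p r"
      "f (p + s *\<^sub>R b + s *\<^sub>R a) - f (p + s *\<^sub>R b) - f (p + s *\<^sub>R a) + f p = s * s * hess f q2 a b"
      using second_difference_mean_value[of p r f b s a, OF dif s sr(2)] by auto
    have "s * s * hess f q1 b a = s * s * hess f q2 a b"
      using q1(2) q2(2) by (simp add: algebra_simps)
    then have "hess f q1 b a = hess f q2 a b" using s by simp
    moreover have "\<bar>hess f q2 a b - hess f p a b\<bar> < e / 2" "\<bar>hess f q1 b a - hess f p b a\<bar> < e / 2"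
      using r1(2)[of q2] r2(2)[of q1] q1(1) q2(1) by (simp_all add: r_def)
    ultimately show ?thesis by linarith
  qed
  then have "\<bar>hess f p a b - hess f p b a\<bar> \<le> 0" by (rule field_le_epsilon[where y=0, simplified])
  then show ?thesis by simp
qed

lemma hess_commute:
  fixes f :: "'a::real_normed_vector \<Rightarrow> 'b::real_inner"
  assumes "open S" and "smooth_on S f" and "p \<in> S"
  shows "hess f p a b = hess f p b a"
proof -
  have smooth_D: "smooth_on S (\<lambda>q. frechet_derivative f (at q) w)" for w
    by (rule smooth_on_frechet_derivative[OF assms(2)])
  have inner_D: "frechet_derivative (\<lambda>q. g q \<bullet> e) (at q) w = frechet_derivative g (at q) w \<bullet> e"
    if "g differentiable (at q)" for g :: "'a \<Rightarrow> 'b" and e q w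
  proof -
    have "((\<lambda>q. g q \<bullet> e) has_derivative (\<lambda>w. frechet_derivative g (at q) w \<bullet> e)) (at q)"
      using that by (intro has_derivative_inner_left) (simp add: frechet_derivative_works)
    from frechet_derivative_at[OF this] show ?thesis by metis
  qed
  have hess_inner: "hess (\<lambda>q. f q \<bullet> e) p v w = hess f p v w \<bullet> e" for e v w
  proof -
    have "((\<lambda>q. frechet_derivative f (at q) w \<bullet> e) has_derivative
        (\<lambda>v. hess f p v w \<bullet> e)) (at p)"
      unfolding hess_def using smooth_on_imp_differentiable[OF smooth_D assms(3)]
      by (intro has_derivative_inner_left) (simp add: frechet_derivative_works)
    then have "((\<lambda>q. frechet_derivative (\<lambda>q. f q \<bullet> e) (at q) w) has_derivative
        (\<lambda>v. hess f p v w \<bullet> e)) (at p)"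
    proof (rule has_derivative_transform_within_open[OF _ assms(1,3)])
      fix q assume "q \<in> S"
      then show "frechet_derivative f (at q) w \<bullet> e = frechet_derivative (\<lambda>q. f q \<bullet> e) (at q) w"
        using smooth_on_imp_differentiable[OF assms(2)] by (simp add: inner_D)
    qed
    from frechet_derivative_at[OF this] show ?thesis
      unfolding hess_def[of "\<lambda>q. f q \<bullet> e"] by metis
  qed
  have "hess f p a b \<bullet> e = hess f p b a \<bullet> e" for e
    using hess_commute_real[OF assms(1) smooth_on_bilinear[OF assms(1) bounded_bilinear_inner assms(2)
          smooth_on_const] assms(3), of e a b]
    by (simp add: hess_inner)
  then show ?thesis by (metis vector_eq_rdot)
qed

lemma linear_param:
  assumes "linear f"
  shows "f (a :: param) = fst a *\<^sub>R f (1, 0) + snd a *\<^sub>R f (0, 1)"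
proof -
  have "a = fst a *\<^sub>R (1, 0) + snd a *\<^sub>R (0, 1)" by (simp add: prod_eq_iff)
  then have "f a = f (fst a *\<^sub>R (1, 0) + snd a *\<^sub>R (0, 1))" by simp
  then show ?thesis by (simp only: linear_add[OF assms] linear_scale[OF assms])
qed

lemma linear_hess_left:
  assumes "smooth_on U f" and "p \<in> U"
  shows "linear (\<lambda>a. hess f p a b)"
  unfolding hess_def
  using linear_frechet_derivative[OF smooth_on_imp_differentiable[OF
        smooth_on_frechet_derivative[OF assms(1)] assms(2)]] by simp

lemma linear_hess_right:
  fixes f :: "'a::real_normed_vector \<Rightarrow> 'b::real_inner"
  assumes "open U" and "smooth_on U f" and "p \<in> U"
  shows "linear (hess f p a)"
proof -
  have "hess f p a = (\<lambda>b. hess f p b a)" using hess_commute[OF assms] by blast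
  then show ?thesis using linear_hess_left[OF assms(2,3)] by simp
qed

text \<open>
  Differentiating the derivative of \<open>f\<close> along a vector field \<open>Y\<close> gives one term from the
  variation of \<open>Y\<close> and one second derivative of \<open>f\<close>.  Applied to the surface itself, the first
  term is tangential; this is why the second fundamental form is tensorial.
\<close>
lemma has_derivative_along_field:
  fixes f :: "param \<Rightarrow> 'b::real_inner"
  assumes "open U" and f: "smooth_on U f" and p: "p \<in> U" and Y: "(Y has_derivative Y') (at p)"
  shows "((\<lambda>q. frechet_derivative f (at q) (Y q)) has_derivative
    (\<lambda>a. frechet_derivative f (at p) (Y' a) + hess f p a (Y p))) (at p)"
proof (rule has_derivative_transform_within_open[OF _ \<open>open U\<close> p])
  have lin: "linear (frechet_derivative f (at q))" if "q \<in> U" for q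
    by (rule linear_frechet_derivative[OF smooth_on_imp_differentiable[OF f that]])
  let ?D = "\<lambda>b q. frechet_derivative f (at q) b"
  have D: "(?D b has_derivative (\<lambda>a. hess f p a b)) (at p)" for b
    unfolding hess_def frechet_derivative_works[symmetric]
    by (rule smooth_on_imp_differentiable[OF smooth_on_frechet_derivative[OF f] p])
  have "((\<lambda>q. fst (Y q) *\<^sub>R ?D (1, 0) q + snd (Y q) *\<^sub>R ?D (0, 1) q) has_derivative
      (\<lambda>a. (fst (Y p) *\<^sub>R hess f p a (1, 0) + fst (Y' a) *\<^sub>R ?D (1, 0) p) +
           (snd (Y p) *\<^sub>R hess f p a (0, 1) + snd (Y' a) *\<^sub>R ?D (0, 1) p))) (at p)"
    by (intro has_derivative_add has_derivative_scaleR has_derivative_fst has_derivative_snd Y D)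
  moreover have "(fst (Y p) *\<^sub>R hess f p a (1, 0) + fst (Y' a) *\<^sub>R ?D (1, 0) p) +
      (snd (Y p) *\<^sub>R hess f p a (0, 1) + snd (Y' a) *\<^sub>R ?D (0, 1) p) =
      ?D (Y' a) p + hess f p a (Y p)" for a
    using linear_param[OF lin[OF p], of "Y' a"]
      linear_param[OF linear_hess_right[OF \<open>open U\<close> f p], of a "Y p"] by simp
  ultimately show "((\<lambda>q. fst (Y q) *\<^sub>R ?D (1, 0) q + snd (Y q) *\<^sub>R ?D (0, 1) q) has_derivative
      (\<lambda>a. ?D (Y' a) p + hess f p a (Y p))) (at p)" by simp
  show "fst (Y q) *\<^sub>R ?D (1, 0) q + snd (Y q) *\<^sub>R ?D (0, 1) q = ?D (Y q) q" if "q \<in> U" for q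
    using linear_param[OF lin[OF that], of "Y q"] by simp
qed

lemma differentiable_inverse_sqrt:
  fixes f :: "'a::real_normed_vector \<Rightarrow> real"
  assumes "f differentiable (at p)" and "f p > 0"
  shows "(\<lambda>q. 1 / sqrt (f q)) differentiable (at p)"
proof -
  have "sqrt differentiable (at (f p))"
    using DERIV_real_sqrt[OF assms(2)] by (auto simp: real_differentiable_def)
  then have "(\<lambda>q. sqrt (f q)) differentiable (at p)"
    using differentiable_chain_at[OF assms(1)] by (simp add: o_def)
  then show ?thesis using assms(2) by (intro differentiable_divide) simp_all
qed

lemma differentiable_Pair:
  assumes "f differentiable (at p)" and "g differentiable (at p)"
  shows "(\<lambda>q. (f q, g q)) differentiable (at p)"
proof -
  obtain f' g' where "(f has_derivative f') (at p)" "(g has_derivative g') (at p)"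
    using assms by (auto simp: differentiable_def)
  from has_derivative_Pair[OF this] show ?thesis by (rule differentiableI)
qed

section \<open>The indefinite inner product\<close>

lemma ip22_commute: "ip22 a b = ip22 b a"
  by (simp add: ip22_def)

lemma bounded_bilinear_ip22: "bounded_bilinear ip22"
  unfolding bilinear_conv_bounded_bilinear[symmetric] bilinear_def
  by (auto intro!: linearI simp: ip22_def algebra_simps)

interpretation ip22: bounded_bilinear ip22
  by (rule bounded_bilinear_ip22)

lemma ip22_nondegenerate:
  assumes "\<And>v. ip22 w v = 0"
  shows "w = 0"
proof -
  have "w $ 1 = 0" "w $ 2 = 0" "w $ 3 = 0" "w $ 4 = 0"
    using assms[of "axis 1 1"] assms[of "axis 2 1"] assms[of "axis 3 1"] assms[of "axis 4 1"]
    by (simp_all add: ip22_def axis_def)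
  then show ?thesis by (simp add: vec_eq_iff forall_4)
qed

text \<open>
  Four pairwise orthogonal vectors none of which is null are linearly independent, hence span the
  space, and the scalar product is non-degenerate.
\<close>
lemma orthogonal_to_orthogonal_basis:
  assumes nz: "ip22 e1 e1 \<noteq> 0" "ip22 e2 e2 \<noteq> 0" "ip22 e3 e3 \<noteq> 0" "ip22 e4 e4 \<noteq> 0"
    and orth: "ip22 e1 e2 = 0" "ip22 e1 e3 = 0" "ip22 e1 e4 = 0"
      "ip22 e2 e3 = 0" "ip22 e2 e4 = 0" "ip22 e3 e4 = 0"
    and w: "ip22 w e1 = 0" "ip22 w e2 = 0" "ip22 w e3 = 0" "ip22 w e4 = 0"
  shows "w = 0"
proof (rule ip22_nondegenerate)
  fix v
  define f :: "real ^ 4 \<Rightarrow> real ^ 4"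
    where "f c = c $ 1 *\<^sub>R e1 + c $ 2 *\<^sub>R e2 + c $ 3 *\<^sub>R e3 + c $ 4 *\<^sub>R e4" for c
  have lin: "linear f" by (intro linearI) (simp_all add: f_def algebra_simps)
  have "c = 0" if "f c = 0" for c
  proof -
    have "ip22 e1 (f c) = 0" "ip22 e2 (f c) = 0" "ip22 e3 (f c) = 0" "ip22 e4 (f c) = 0"
      using that by (simp_all add: ip22.zero_right)
    moreover have "ip22 e1 (f c) = c $ 1 * ip22 e1 e1" "ip22 e2 (f c) = c $ 2 * ip22 e2 e2"
      "ip22 e3 (f c) = c $ 3 * ip22 e3 e3" "ip22 e4 (f c) = c $ 4 * ip22 e4 e4"
      using orth orth[THEN ip22_commute[THEN trans]]
      by (simp_all add: f_def ip22.add_right ip22.scaleR_right)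
    ultimately show ?thesis using nz by (simp add: vec_eq_iff forall_4)
  qed
  then have "inj f" using lin by (simp add: linear_injective_0)
  then have "surj f" using lin by (simp add: linear_injective_imp_surjective)
  then obtain c where "v = f c" by (metis surjD)
  then show "ip22 w v = 0"
    using w by (simp add: f_def ip22.add_right ip22.scaleR_right)
qed

text \<open>
  If the rows of a matrix \<open>Q\<close> are orthonormal for \<open>D = diag(E, G)\<close>, that is, if
  \<open>Q D Q\<^sup>T = J\<close> with \<open>J = diag(1, -1)\<close>, then \<open>Q\<^sup>T J Q\<close> is the inverse of \<open>D\<close>.  This is the
  reason that the trace in the definition of the mean curvature does not depend on the
  orthonormal basis.
\<close>
lemma lorentz_orthonormal_pair_completeness:
  fixes E G :: real
  assumes "E > 0" "G < 0"
    and xx: "E * x1\<^sup>2 + G * x2\<^sup>2 = 1" and yy: "E * y1\<^sup>2 + G * y2\<^sup>2 = -1"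
    and xy: "E * x1 * y1 + G * x2 * y2 = 0"
  shows "E * (x1\<^sup>2 - y1\<^sup>2) = 1" and "G * (x2\<^sup>2 - y2\<^sup>2) = 1" and "x1 * x2 = y1 * y2"
proof -
  have sq: "(E * x1\<^sup>2) * (E * y1\<^sup>2) = (G * x2\<^sup>2) * (G * y2\<^sup>2)"
    using xy by algebra
  have e: "E * x1\<^sup>2 = 1 - G * x2\<^sup>2" "E * y1\<^sup>2 = -1 - G * y2\<^sup>2" using xx yy by simp_all
  show G1: "G * (x2\<^sup>2 - y2\<^sup>2) = 1" using sq unfolding e by (simp add: algebra_simps)
  show "E * (x1\<^sup>2 - y1\<^sup>2) = 1" using G1 e by (simp add: algebra_simps)
  have "G * x2\<^sup>2 \<le> 0" using \<open>G < 0\<close> by (simp add: mult_nonpos_nonneg)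
  then have "x1 \<noteq> 0" using e(1) by auto
  have "E * x1 * (x1 * x2 - y1 * y2) = 0" using xy G1 e(1) by algebra
  then show "x1 * x2 = y1 * y2" using \<open>E > 0\<close> \<open>x1 \<noteq> 0\<close> by simp
qed

section \<open>Orthogonal parameters and the second fundamental form\<close>

text \<open>
  The parameter-plane coordinates of the tangential part of \<open>w\<close>, provided that \<open>F = 0\<close>.
\<close>
definition tan_coord :: "(param \<Rightarrow> real ^ 4) \<Rightarrow> param \<Rightarrow> real ^ 4 \<Rightarrow> param" where
  "tan_coord z p w = (ip22 w (d_u z p) / coef_E z p, ip22 w (d_v z p) / coef_G z p)"

text \<open>
  The shape operator of the normal vector \<open>n\<close>, again provided that \<open>F = 0\<close>: then it represents
  the bilinear form \<open>\<langle>\<sigma>(a, b), n\<rangle>\<close> with respect to the first fundamental form.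
\<close>
definition shape_op :: "(param \<Rightarrow> real ^ 4) \<Rightarrow> param \<Rightarrow> real ^ 4 \<Rightarrow> param \<Rightarrow> param" where
  "shape_op z p n a =
    (ip22 n (hess z p a (1, 0)) / coef_E z p, ip22 n (hess z p a (0, 1)) / coef_G z p)"

text \<open>
  By \<open>second_ff_eq\<close> the second fundamental form of two vector fields is determined by their values at
  the point; this is the resulting bilinear form on the parameter plane.
\<close>
definition sff :: "(param \<Rightarrow> real ^ 4) \<Rightarrow> param \<Rightarrow> param \<Rightarrow> param \<Rightarrow> real ^ 4" where
  "sff z p a b = normal_part z p (hess z p a b)"

text \<open>
  For \<open>F = 0\<close> this is \<open>\<sigma>(x, x) + \<sigma>(y, y)\<close> with \<open>x\<close>, \<open>y\<close> the normalized coordinate vectors.  The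
  minus sign is due to \<open>G < 0\<close>; the trace of \<open>\<sigma>\<close> has the opposite sign in the second term.
\<close>
definition sff_sum :: "(param \<Rightarrow> real ^ 4) \<Rightarrow> param \<Rightarrow> real ^ 4" where
  "sff_sum z p = (1 / coef_E z p) *\<^sub>R sff z p (1, 0) (1, 0) - (1 / coef_G z p) *\<^sub>R sff z p (0, 1) (0, 1)"

locale orthogonal_chart =
  fixes U :: "param set" and z :: "param \<Rightarrow> real ^ 4"
  assumes open_U: "open U" and smooth_z: "smooth_on U z"
    and E_pos: "p \<in> U \<Longrightarrow> coef_E z p > 0" and G_neg: "p \<in> U \<Longrightarrow> coef_G z p < 0"
    and F_zero: "p \<in> U \<Longrightarrow> coef_F z p = 0"
begin

lemma ip_uu: "ip22 (d_u z p) (d_u z p) = coef_E z p"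
  and ip_vv: "ip22 (d_v z p) (d_v z p) = coef_G z p"
  by (simp_all add: coef_E_def coef_G_def)

lemma ip_uv: "p \<in> U \<Longrightarrow> ip22 (d_u z p) (d_v z p) = 0"
  and ip_vu: "p \<in> U \<Longrightarrow> ip22 (d_v z p) (d_u z p) = 0"
  using F_zero by (simp_all add: coef_F_def ip22_commute)

lemma dz_eq: "p \<in> U \<Longrightarrow> dz z p a = fst a *\<^sub>R d_u z p + snd a *\<^sub>R d_v z p"
  unfolding dz_def d_u_def d_v_def
  by (rule linear_param[OF linear_frechet_derivative[OF smooth_on_imp_differentiable[OF smooth_z]]])

lemma normal_space_iff:
  assumes "p \<in> U"
  shows "n \<in> normal_space z p \<longleftrightarrow> ip22 n (d_u z p) = 0 \<and> ip22 n (d_v z p) = 0"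
proof
  assume n: "n \<in> normal_space z p"
  have uv: "d_u z p = dz z p (1, 0)" "d_v z p = dz z p (0, 1)" by (simp_all add: dz_eq[OF assms])
  then show "ip22 n (d_u z p) = 0 \<and> ip22 n (d_v z p) = 0"
    using n unfolding uv by (simp add: normal_space_def tangent_space_def)
next
  assume "ip22 n (d_u z p) = 0 \<and> ip22 n (d_v z p) = 0"
  then show "n \<in> normal_space z p"
    by (auto simp: normal_space_def tangent_space_def dz_eq[OF assms] ip22.add_right ip22.scaleR_right)
qed

text \<open>
  The tangential part solves a linear system with matrix \<open>diag(E, G)\<close>.
\<close>
lemma normal_part_eq:
  assumes p: "p \<in> U"
  shows "normal_part z p w = w - dz z p (tan_coord z p w)"
  unfolding normal_part_def
proof (rule the_equality)
  note ips = ip_uu ip_vv ip_uv[OF p] ip_vu[OF p]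
  have EG: "coef_E z p \<noteq> 0" "coef_G z p \<noteq> 0" using E_pos[OF p] G_neg[OF p] by auto
  show "w - dz z p (tan_coord z p w) \<in> normal_space z p \<and>
      w - (w - dz z p (tan_coord z p w)) \<in> tangent_space z p"
    using EG
    by (simp add: normal_space_iff[OF p] tangent_space_def)
      (simp add: dz_eq[OF p] tan_coord_def ips ip22.add_left ip22.diff_left ip22.scaleR_left)
  fix n assume n: "n \<in> normal_space z p \<and> w - n \<in> tangent_space z p"
  then obtain a where a: "w - n = dz z p a" by (auto simp: tangent_space_def)
  then have w: "w = n + dz z p a" by (simp add: algebra_simps)
  have "tan_coord z p w = a"
    using n EG unfolding w
    by (simp add: normal_space_iff[OF p] dz_eq[OF p] tan_coord_def ips ip22.add_left
        ip22.scaleR_left prod_eq_iff)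
  then show "n = w - dz z p (tan_coord z p w)" using w by simp
qed

lemma linear_normal_part:
  assumes "p \<in> U"
  shows "linear (normal_part z p)"
proof (rule linearI)
  show "normal_part z p (v + w) = normal_part z p v + normal_part z p w" for v w
    by (simp add: normal_part_eq[OF assms] dz_eq[OF assms] tan_coord_def ip22.add_left
        add_divide_distrib scaleR_left_distrib)
  show "normal_part z p (c *\<^sub>R w) = c *\<^sub>R normal_part z p w" for c w
    by (simp add: normal_part_eq[OF assms] dz_eq[OF assms] tan_coord_def ip22.scaleR_left
        scaleR_right_distrib scaleR_right_diff_distrib)
qed

lemma E_nz: "p \<in> U \<Longrightarrow> coef_E z p \<noteq> 0" and G_nz: "p \<in> U \<Longrightarrow> coef_G z p \<noteq> 0"
  using E_pos[of p] G_neg[of p] by auto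

lemma normal_part_in_normal_space: "p \<in> U \<Longrightarrow> normal_part z p w \<in> normal_space z p"
  by (simp add: normal_space_iff normal_part_eq dz_eq tan_coord_def ip_uu ip_vv ip_uv ip_vu
      E_nz G_nz ip22.add_left ip22.diff_left ip22.scaleR_left)

lemma normal_part_dz: "p \<in> U \<Longrightarrow> normal_part z p (dz z p a) = 0"
  by (simp add: normal_part_eq dz_eq tan_coord_def ip_uu ip_vv ip_uv ip_vu
      E_nz G_nz ip22.add_left ip22.scaleR_left)

lemma ip22_normal_part:
  "p \<in> U \<Longrightarrow> n \<in> normal_space z p \<Longrightarrow> ip22 n (normal_part z p w) = ip22 n w"
  by (simp add: normal_space_iff normal_part_eq dz_eq ip22.diff_right ip22.add_right
      ip22.scaleR_right)

lemma second_ff_eq: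
  assumes "p \<in> U" and "Y differentiable (at p)"
  shows "second_ff z X Y p = sff z p (X p) (Y p)"
proof -
  have "((\<lambda>q. dz z q (Y q)) has_derivative
      (\<lambda>a. dz z p (frechet_derivative Y (at p) a) + hess z p a (Y p))) (at p)"
    unfolding dz_def using assms(2)
    by (intro has_derivative_along_field[OF open_U smooth_z assms(1)])
      (simp add: frechet_derivative_works)
  from fun_cong[OF frechet_derivative_at[OF this], of "X p"]
  have "nabla' X (\<lambda>q. dz z q (Y q)) p = dz z p (frechet_derivative Y (at p) (X p)) + hess z p (X p) (Y p)"
    by (simp add: nabla'_def)
  then show ?thesis
    by (simp add: second_ff_def sff_def linear_add[OF linear_normal_part[OF assms(1)]]
        normal_part_dz[OF assms(1)])
qed

lemma sff_expand:
  assumes "p \<in> U"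
  shows "sff z p a b = (fst a * fst b) *\<^sub>R sff z p (1, 0) (1, 0)
    + (fst a * snd b + snd a * fst b) *\<^sub>R sff z p (0, 1) (1, 0) + (snd a * snd b) *\<^sub>R sff z p (0, 1) (0, 1)"
proof -
  have "hess z p a b = fst a *\<^sub>R (fst b *\<^sub>R hess z p (1, 0) (1, 0) + snd b *\<^sub>R hess z p (0, 1) (1, 0)) +
      snd a *\<^sub>R (fst b *\<^sub>R hess z p (0, 1) (1, 0) + snd b *\<^sub>R hess z p (0, 1) (0, 1))"
    using linear_param[OF linear_hess_left[OF smooth_z assms], of a b]
      linear_param[OF linear_hess_right[OF open_U smooth_z assms], of "(1, 0)" b]
      linear_param[OF linear_hess_right[OF open_U smooth_z assms], of "(0, 1)" b]
      hess_commute[OF open_U smooth_z assms, of "(1, 0)" "(0, 1)"] by simp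
  then show ?thesis
    unfolding sff_def
    by (simp add: linear_add[OF linear_normal_part[OF assms]]
        linear_scale[OF linear_normal_part[OF assms]] algebra_simps)
qed

lemma sff_in_normal_space: "p \<in> U \<Longrightarrow> sff z p a b \<in> normal_space z p"
  by (simp add: sff_def normal_part_in_normal_space)

lemma smooth_d_u: "smooth_on U (d_u z)" and smooth_d_v: "smooth_on U (d_v z)"
  unfolding d_u_def[abs_def] d_v_def[abs_def] by (intro smooth_on_frechet_derivative smooth_z)+

lemma smooth_coef_E: "smooth_on U (coef_E z)" and smooth_coef_G: "smooth_on U (coef_G z)"
  unfolding coef_E_def[abs_def] coef_G_def[abs_def]
  by (intro smooth_on_bilinear[OF open_U bounded_bilinear_ip22] smooth_d_u smooth_d_v)+

lemma first_ff_eq: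
  "p \<in> U \<Longrightarrow> first_ff z p a b = coef_E z p * fst a * fst b + coef_G z p * snd a * snd b"
  by (simp add: first_ff_def dz_eq ip22.add_left ip22.add_right ip22.scaleR_left ip22.scaleR_right
      ip_uu ip_vv ip_uv ip_vu)

text \<open>
  The value is the same for all orthonormal pairs by
  \<open>lorentz_orthonormal_pair_completeness\<close>.  Constant fields provide such a pair at \<open>p\<close>, which makes
  the value unique.
\<close>
lemma mean_curvature_eq:
  assumes p: "p \<in> U"
  shows "mean_curvature U z p = (1/2) *\<^sub>R
    ((1 / coef_E z p) *\<^sub>R sff z p (1, 0) (1, 0) + (1 / coef_G z p) *\<^sub>R sff z p (0, 1) (0, 1))"
  unfolding mean_curvature_def
proof (rule the_equality)
  note E = E_pos[OF p] and G = G_neg[OF p]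
  let ?H = "(1/2) *\<^sub>R
    ((1 / coef_E z p) *\<^sub>R sff z p (1, 0) (1, 0) + (1 / coef_G z p) *\<^sub>R sff z p (0, 1) (0, 1))"
  show *: "\<forall>X Y. smooth_on U X \<and> smooth_on U Y \<and> tangent_orthonormal z p (X p) (Y p) \<longrightarrow>
      ?H = (1/2) *\<^sub>R (second_ff z X X p - second_ff z Y Y p)"
  proof (intro allI impI, elim conjE)
    fix X Y :: "param \<Rightarrow> param"
    assume sm: "smooth_on U X" "smooth_on U Y" and on: "tangent_orthonormal z p (X p) (Y p)"
    obtain x1 x2 y1 y2 where xy: "X p = (x1, x2)" "Y p = (y1, y2)" by (metis surj_pair)
    have "coef_E z p * (x1\<^sup>2 - y1\<^sup>2) = 1" "coef_G z p * (x2\<^sup>2 - y2\<^sup>2) = 1" "x1 * x2 = y1 * y2"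
      using lorentz_orthonormal_pair_completeness[OF E G, of x1 x2 y1 y2] on
      by (simp_all add: tangent_orthonormal_def first_ff_eq[OF p] xy power2_eq_square algebra_simps)
    then have "1 / coef_E z p = x1 * x1 - y1 * y1" "1 / coef_G z p = x2 * x2 - y2 * y2"
      "x1 * x2 = y1 * y2"
      using E G by (simp_all add: field_simps power2_eq_square)
    moreover have "second_ff z X X p - second_ff z Y Y p =
        (x1 * x1 - y1 * y1) *\<^sub>R sff z p (1, 0) (1, 0) + (2 * (x1 * x2 - y1 * y2)) *\<^sub>R sff z p (0, 1) (1, 0)
        + (x2 * x2 - y2 * y2) *\<^sub>R sff z p (0, 1) (0, 1)"
      using sff_expand[OF p, of "X p" "X p"] sff_expand[OF p, of "Y p" "Y p"]
      by (simp add: second_ff_eq[OF p] smooth_on_imp_differentiable[OF _ p] sm xy algebra_simps)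
    ultimately show "?H = (1/2) *\<^sub>R (second_ff z X X p - second_ff z Y Y p)"
      by simp
  qed
  fix h
  assume h: "\<forall>X Y. smooth_on U X \<and> smooth_on U Y \<and> tangent_orthonormal z p (X p) (Y p) \<longrightarrow>
      h = (1/2) *\<^sub>R (second_ff z X X p - second_ff z Y Y p)"
  have "tangent_orthonormal z p (1 / sqrt (coef_E z p), 0) (0, 1 / sqrt (- coef_G z p))"
    using E G by (simp add: tangent_orthonormal_def first_ff_eq[OF p])
  then show "h = ?H"
    using h[rule_format, of "\<lambda>_. (1 / sqrt (coef_E z p), 0)" "\<lambda>_. (0, 1 / sqrt (- coef_G z p))"]
      *[rule_format, of "\<lambda>_. (1 / sqrt (coef_E z p), 0)" "\<lambda>_. (0, 1 / sqrt (- coef_G z p))"]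
    by (simp add: smooth_on_const)
qed

section \<open>The geometric functions\<close>

lemma second_ff_x_field:
  assumes p: "p \<in> U"
  shows "second_ff z (x_field z) (x_field z) p = (1 / coef_E z p) *\<^sub>R sff z p (1, 0) (1, 0)"
proof -
  have "(\<lambda>q. 1 / sqrt (coef_E z q)) differentiable (at p)"
    by (rule differentiable_inverse_sqrt)
      (use smooth_on_imp_differentiable[OF smooth_coef_E p] E_pos[OF p] in simp_all)
  then have "x_field z differentiable (at p)"
    unfolding x_field_def[abs_def] by (intro differentiable_Pair) simp_all
  then show ?thesis
    using sff_expand[OF p, of "x_field z p" "x_field z p"] E_pos[OF p]
    by (simp add: second_ff_eq[OF p] x_field_def)
qed

lemma second_ff_y_field:
  assumes p: "p \<in> U"
  shows "second_ff z (y_field z) (y_field z) p = - (1 / coef_G z p) *\<^sub>R sff z p (0, 1) (0, 1)"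
proof -
  have "(\<lambda>q. 1 / sqrt (- coef_G z q)) differentiable (at p)"
  proof (rule differentiable_inverse_sqrt)
    show "(\<lambda>q. - coef_G z q) differentiable (at p)"
      by (rule differentiable_minus[OF smooth_on_imp_differentiable[OF smooth_coef_G p]])
    show "- coef_G z p > 0" using G_neg[OF p] by simp
  qed
  then have "y_field z differentiable (at p)"
    unfolding y_field_def[abs_def] by (intro differentiable_Pair) simp_all
  then show ?thesis
    using sff_expand[OF p, of "y_field z p" "y_field z p"] G_neg[OF p]
    by (simp add: second_ff_eq[OF p] y_field_def)
qed

lemma nu_sum_eq:
  assumes p: "p \<in> U"
  shows "nu1 U z p + nu2 U z p = ip22 (sff_sum z p) (b_field U z p)"
  unfolding nu1_def nu2_def second_ff_x_field[OF p] second_ff_y_field[OF p] sff_sum_def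
  by (simp add: ip22.diff_left ip22.scaleR_left ip22.minus_left)

section \<open>The Ricci equation\<close>

text \<open>
  Differentiate \<open>\<langle>\<xi>, dz b\<rangle> = 0\<close> for a constant direction \<open>b\<close>.
\<close>
lemma weingarten:
  assumes p: "p \<in> U" and \<xi>: "normal_field U z \<xi>"
  shows "ip22 (frechet_derivative \<xi> (at p) a) (frechet_derivative z (at p) b) = - ip22 (\<xi> p) (hess z p a b)"
proof -
  let ?Db = "\<lambda>q. frechet_derivative z (at q) b"
  have "smooth_on U \<xi>" using \<xi> by (simp add: normal_field_def)
  then have "((\<lambda>q. ip22 (\<xi> q) (?Db q)) has_derivative
      (\<lambda>a. ip22 (\<xi> p) (hess z p a b) + ip22 (frechet_derivative \<xi> (at p) a) (?Db p))) (at p)"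
    unfolding hess_def
    using smooth_on_imp_differentiable[OF smooth_on_frechet_derivative[OF smooth_z] p, of b]
    by (intro ip22.FDERIV) (simp_all add: smooth_on_imp_differentiable[OF _ p] frechet_derivative_works[symmetric])
  then have "((\<lambda>q. 0) has_derivative
      (\<lambda>a. ip22 (\<xi> p) (hess z p a b) + ip22 (frechet_derivative \<xi> (at p) a) (?Db p))) (at p)"
  proof (rule has_derivative_transform_within_open[OF _ open_U p])
    show "ip22 (\<xi> q) (?Db q) = 0" if "q \<in> U" for q
      using \<xi> that by (cases b) (simp add: normal_field_def normal_space_def tangent_space_def dz_def)
  qed
  from fun_cong[OF has_derivative_unique[OF this has_derivative_const], of a]
  show ?thesis by simp
qed

text \<open>
  The Weingarten formula: the tangential part of the ambient derivative of \<open>\<xi>\<close> is minus the shape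
  operator.
\<close>
lemma normal_conn_eq:
  assumes p: "p \<in> U" and \<xi>: "normal_field U z \<xi>"
  shows "normal_conn z X \<xi> p =
    frechet_derivative \<xi> (at p) (X p) + frechet_derivative z (at p) (shape_op z p (\<xi> p) (X p))"
proof -
  have "tan_coord z p (frechet_derivative \<xi> (at p) (X p)) = - shape_op z p (\<xi> p) (X p)"
    using weingarten[OF assms, of "X p" "(1, 0)"] weingarten[OF assms, of "X p" "(0, 1)"]
    by (simp add: tan_coord_def shape_op_def d_u_def d_v_def)
  then show ?thesis
    by (simp add: normal_conn_def nabla'_def normal_part_eq[OF p] dz_eq[OF p] flip: dz_def)
qed

lemma differentiable_shape_op:
  assumes p: "p \<in> U" and \<xi>: "smooth_on U \<xi>" and Y: "Y differentiable (at p)"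
  shows "(\<lambda>q. shape_op z q (\<xi> q) (Y q)) differentiable (at p)"
proof -
  have "(\<lambda>q. ip22 (\<xi> q) (hess z q (Y q) b)) differentiable (at p)" for b
  proof -
    have "(\<xi> has_derivative frechet_derivative \<xi> (at p)) (at p)"
      using smooth_on_imp_differentiable[OF \<xi> p] by (simp add: frechet_derivative_works)
    moreover have "(Y has_derivative frechet_derivative Y (at p)) (at p)"
      using Y by (simp add: frechet_derivative_works)
    note has_derivative_along_field[OF open_U smooth_on_frechet_derivative[OF smooth_z] p this, of b]
    ultimately show ?thesis
      unfolding hess_def by (rule differentiableI[OF ip22.FDERIV])
  qed
  then show ?thesis
    unfolding shape_op_def
    using E_nz[OF p] G_nz[OF p] smooth_on_imp_differentiable[OF smooth_coef_E p]
      smooth_on_imp_differentiable[OF smooth_coef_G p]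
    by (intro differentiable_Pair differentiable_divide)
qed

text \<open>
  In \<open>normal_conn_eq\<close> the tangential correction is a vector field \<open>T\<close> along the surface.  Its
  derivative contributes to the normal space only through the second fundamental form.
\<close>
lemma normal_conn_normal_conn:
  assumes p: "p \<in> U" and \<xi>: "normal_field U z \<xi>" and Y: "Y differentiable (at p)"
  shows "normal_conn z X (normal_conn z Y \<xi>) p =
    normal_part z p (frechet_derivative \<xi> (at p) (frechet_derivative Y (at p) (X p)) + hess \<xi> p (X p) (Y p))
    + sff z p (X p) (shape_op z p (\<xi> p) (Y p))"
proof -
  have sm: "smooth_on U \<xi>" using \<xi> by (simp add: normal_field_def)
  define T where "T q = shape_op z q (\<xi> q) (Y q)" for q
  have DT: "(T has_derivative frechet_derivative T (at p)) (at p)"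
    unfolding T_def frechet_derivative_works[symmetric] by (rule differentiable_shape_op[OF p sm Y])
  have DY: "(Y has_derivative frechet_derivative Y (at p)) (at p)"
    using Y by (simp add: frechet_derivative_works)
  have "(normal_conn z Y \<xi> has_derivative
      (\<lambda>a. (frechet_derivative \<xi> (at p) (frechet_derivative Y (at p) a) + hess \<xi> p a (Y p)) +
           (frechet_derivative z (at p) (frechet_derivative T (at p) a) + hess z p a (T p)))) (at p)"
  proof (rule has_derivative_transform_within_open[OF _ open_U p])
    show "((\<lambda>q. frechet_derivative \<xi> (at q) (Y q) + frechet_derivative z (at q) (T q)) has_derivative
      (\<lambda>a. (frechet_derivative \<xi> (at p) (frechet_derivative Y (at p) a) + hess \<xi> p a (Y p)) +
           (frechet_derivative z (at p) (frechet_derivative T (at p) a) + hess z p a (T p)))) (at p)"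
      by (intro has_derivative_add has_derivative_along_field[OF open_U] sm smooth_z p DY DT)
    show "frechet_derivative \<xi> (at q) (Y q) + frechet_derivative z (at q) (T q) = normal_conn z Y \<xi> q"
      if "q \<in> U" for q
      by (simp add: normal_conn_eq[OF that \<xi>] T_def)
  qed
  from fun_cong[OF frechet_derivative_at[OF this], of "X p"]
  have "nabla' X (normal_conn z Y \<xi>) p =
      (frechet_derivative \<xi> (at p) (frechet_derivative Y (at p) (X p)) + hess \<xi> p (X p) (Y p)) +
      (dz z p (frechet_derivative T (at p) (X p)) + hess z p (X p) (T p))"
    by (simp add: nabla'_def dz_def)
  then show ?thesis
    using linear_add[OF linear_normal_part[OF p]] normal_part_dz[OF p]
    by (simp add: normal_conn_def[of z X "normal_conn z Y \<xi>"] sff_def T_def)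
qed

text \<open>
  The terms that contain derivatives of \<open>\<xi>\<close> form the curvature of the flat ambient connection:
  they cancel because second derivatives commute.
\<close>
lemma ricci_equation:
  assumes p: "p \<in> U" and \<xi>: "normal_field U z \<xi>"
    and X: "X differentiable (at p)" and Y: "Y differentiable (at p)"
  shows "normal_curvature_tensor z X Y \<xi> p =
    sff z p (X p) (shape_op z p (\<xi> p) (Y p)) - sff z p (Y p) (shape_op z p (\<xi> p) (X p))"
proof -
  let ?D = "frechet_derivative \<xi> (at p)"
  have sm: "smooth_on U \<xi>" using \<xi> by (simp add: normal_field_def)
  have lin: "linear ?D" by (rule linear_frechet_derivative[OF smooth_on_imp_differentiable[OF sm p]])
  note np = linear_add[OF linear_normal_part[OF p]] linear_diff[OF linear_normal_part[OF p]]
  show ?thesis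
    unfolding normal_curvature_tensor_def normal_conn_normal_conn[OF p \<xi> X]
      normal_conn_normal_conn[OF p \<xi> Y]
    by (simp add: normal_conn_def nabla'_def lie_bracket_def linear_diff[OF lin] np
        hess_commute[OF open_U sm p, of "Y p" "X p"])
qed

text \<open>
  Expansion of the Ricci equation in the coordinate basis.  The expression is antisymmetric in the
  two fields, hence a multiple of their determinant.
\<close>
lemma normal_curvature_tensor_eq:
  assumes p: "p \<in> U" and \<xi>: "normal_field U z \<xi>"
    and X: "X differentiable (at p)" and Y: "Y differentiable (at p)"
  defines "\<sigma> \<equiv> sff z p (0, 1) (1, 0)"
  shows "normal_curvature_tensor z X Y \<xi> p =
    (fst (X p) * snd (Y p) - snd (X p) * fst (Y p)) *\<^sub>R
      (ip22 (\<xi> p) \<sigma> *\<^sub>R sff_sum z p - ip22 (\<xi> p) (sff_sum z p) *\<^sub>R \<sigma>)"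
proof -
  have n: "\<xi> p \<in> normal_space z p" using \<xi> p by (simp add: normal_field_def)
  define e g where "e = 1 / coef_E z p" and "g = 1 / coef_G z p"
  define A C where "A = sff z p (1, 0) (1, 0)" and "C = sff z p (0, 1) (0, 1)"
  obtain x1 x2 y1 y2 where xy: "X p = (x1, x2)" "Y p = (y1, y2)" by (metis surj_pair)
  have h: "sff z p a b = (fst a * fst b) *\<^sub>R A + (fst a * snd b + snd a * fst b) *\<^sub>R \<sigma> + (snd a * snd b) *\<^sub>R C" for a b
    unfolding A_def C_def \<sigma>_def by (rule sff_expand[OF p])
  have "shape_op z p (\<xi> p) a = (e * ip22 (\<xi> p) (sff z p a (1, 0)), g * ip22 (\<xi> p) (sff z p a (0, 1)))" for a
    by (simp add: shape_op_def sff_def ip22_normal_part[OF p n] e_def g_def)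
  then have shape: "shape_op z p (\<xi> p) a =
      (e * (fst a * ip22 (\<xi> p) A + snd a * ip22 (\<xi> p) \<sigma>), g * (fst a * ip22 (\<xi> p) \<sigma> + snd a * ip22 (\<xi> p) C))" for a
    by (simp add: h ip22.add_right ip22.scaleR_right)
  have S: "sff_sum z p = e *\<^sub>R A - g *\<^sub>R C" by (simp add: sff_sum_def A_def C_def e_def g_def)
  show ?thesis
    unfolding ricci_equation[OF p \<xi> X Y] h shape S xy
    by (simp add: ip22.diff_right ip22.scaleR_right vec_eq_iff forall_4 algebra_simps)
qed

section \<open>Normal frames and flatness of the normal connection\<close>

lemma normal_frame_expand:
  assumes p: "p \<in> U" and nf: "normal_frame U z n1 n2" and w: "w \<in> normal_space z p"
  shows "w = ip22 w (n1 p) *\<^sub>R n1 p - ip22 w (n2 p) *\<^sub>R n2 p"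
proof -
  let ?r = "w - (ip22 w (n1 p) *\<^sub>R n1 p - ip22 w (n2 p) *\<^sub>R n2 p)"
  have n: "n1 p \<in> normal_space z p" "n2 p \<in> normal_space z p" "ip22 (n1 p) (n1 p) = 1"
    "ip22 (n2 p) (n2 p) = -1" "ip22 (n1 p) (n2 p) = 0" "ip22 (n2 p) (n1 p) = 0"
    using nf p by (auto simp: normal_frame_def ip22_commute)
  have perp: "ip22 (n1 p) (d_u z p) = 0" "ip22 (n1 p) (d_v z p) = 0" "ip22 (n2 p) (d_u z p) = 0"
    "ip22 (n2 p) (d_v z p) = 0" "ip22 w (d_u z p) = 0" "ip22 w (d_v z p) = 0"
    using n(1,2) w by (simp_all add: normal_space_iff[OF p])
  have "?r = 0"
    by (rule orthogonal_to_orthogonal_basis[of "d_u z p" "d_v z p" "n1 p" "n2 p"])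
      (use n perp perp[THEN ip22_commute[THEN trans]] in
        \<open>simp_all add: ip_uu ip_vv ip_uv[OF p] E_nz[OF p] G_nz[OF p] ip22.diff_left ip22.scaleR_left\<close>)
  then show ?thesis by simp
qed

text \<open>
  The determinant of two normal vectors with respect to the frame detects linear dependence;
  dividing by \<open>\<langle>w, w\<rangle>\<close>, if it is not zero, exhibits \<open>v\<close> as a multiple of \<open>w\<close>.
\<close>
lemma normal_vectors_proportional:
  assumes p: "p \<in> U" and nf: "normal_frame U z n1 n2"
    and v: "v \<in> normal_space z p" and w: "w \<in> normal_space z p"
    and det: "ip22 v (n1 p) * ip22 w (n2 p) = ip22 w (n1 p) * ip22 v (n2 p)"
  shows "ip22 w w *\<^sub>R v = ip22 v w *\<^sub>R w"
proof -
  define v1 v2 w1 w2 where "v1 = ip22 v (n1 p)" "v2 = ip22 v (n2 p)" "w1 = ip22 w (n1 p)" "w2 = ip22 w (n2 p)"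
  note defs = this
  have ve: "v = v1 *\<^sub>R n1 p - v2 *\<^sub>R n2 p" and we: "w = w1 *\<^sub>R n1 p - w2 *\<^sub>R n2 p"
    using normal_frame_expand[OF p nf v] normal_frame_expand[OF p nf w] by (simp_all add: defs)
  have "ip22 u w = ip22 u (n1 p) * w1 - ip22 u (n2 p) * w2" for u
    by (subst we) (simp add: ip22.diff_right ip22.scaleR_right mult.commute)
  then have ips: "ip22 v w = v1 * w1 - v2 * w2" "ip22 w w = w1 * w1 - w2 * w2"
    by (simp_all add: defs)
  have c: "(w1 * w1 - w2 * w2) * v1 = (v1 * w1 - v2 * w2) * w1"
    "(w1 * w1 - w2 * w2) * v2 = (v1 * w1 - v2 * w2) * w2"
    using det unfolding defs[symmetric] by algebra+
  have "ip22 w w *\<^sub>R v = (ip22 w w * v1) *\<^sub>R n1 p - (ip22 w w * v2) *\<^sub>R n2 p"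
    by (subst ve) (simp add: scaleR_right_diff_distrib)
  also have "\<dots> = (ip22 v w * w1) *\<^sub>R n1 p - (ip22 v w * w2) *\<^sub>R n2 p"
    unfolding ips c ..
  also have "\<dots> = ip22 v w *\<^sub>R w"
    by (subst (3) we) (simp add: scaleR_right_diff_distrib)
  finally show ?thesis .
qed

lemma second_derivative_coefficients:
  assumes p: "p \<in> U" and n: "n p \<in> normal_space z p"
  shows "c11 z n p = ip22 (sff z p (1, 0) (1, 0)) (n p)"
    and "c12 z n p = ip22 (sff z p (0, 1) (1, 0)) (n p)"
    and "c22 z n p = ip22 (sff z p (0, 1) (0, 1)) (n p)"
proof -
  have "ip22 (sff z p a b) (n p) = ip22 (hess z p a b) (n p)" for a b
    using ip22_normal_part[OF p n] by (simp add: sff_def ip22_commute[of _ "n p"])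
  then show "c11 z n p = ip22 (sff z p (1, 0) (1, 0)) (n p)"
    "c12 z n p = ip22 (sff z p (0, 1) (1, 0)) (n p)"
    "c22 z n p = ip22 (sff z p (0, 1) (0, 1)) (n p)"
    by (simp_all add: c11_def c12_def c22_def hess_def d_u_def[abs_def] d_v_def[abs_def])
qed

text \<open>
  The normal projection of a constant vector extends a normal vector to a normal field.
  Multiplied by \<open>E G\<close> it is polynomial in the first derivatives and the metric coefficients, so its
  smoothness follows from the product rule alone.
\<close>
lemma normal_field_through_multiple:
  assumes p: "p \<in> U" and w: "w \<in> normal_space z p"
  obtains \<xi> where "normal_field U z \<xi>" and "\<xi> p = (coef_E z p * coef_G z p) *\<^sub>R w"
proof
  define \<xi> where "\<xi> q = (coef_E z q * coef_G z q) *\<^sub>R w - (coef_G z q * ip22 w (d_u z q)) *\<^sub>R d_u z q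
    - (coef_E z q * ip22 w (d_v z q)) *\<^sub>R d_v z q" for q
  have "smooth_on U \<xi>"
    unfolding \<xi>_def
    by (intro smooth_on_diff[OF open_U] smooth_on_scaleR[OF open_U] smooth_coef_E smooth_coef_G
        smooth_on_bilinear[OF open_U bounded_bilinear_mult]
        smooth_on_bilinear[OF open_U bounded_bilinear_ip22] smooth_d_u smooth_d_v smooth_on_const)
  then show "normal_field U z \<xi>"
    by (simp add: normal_field_def normal_space_iff \<xi>_def ip22.diff_left ip22.scaleR_left
        ip_uu ip_vv ip_uv ip_vu)
  show "\<xi> p = (coef_E z p * coef_G z p) *\<^sub>R w"
    using w by (simp add: \<xi>_def normal_space_iff[OF p])
qed

end

theorem proposition5p3:
  fixes U :: "(real \<times> real) set"
    and z n1 n2 :: "real \<times> real \<Rightarrow> real ^ 4"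
  assumes "lorentz_surface U z"
    and "\<forall>p\<in>U. coef_E z p > 0 \<and> coef_G z p < 0"
    and "normal_frame U z n1 n2"
    and "general_type U z n1 n2"
    and "principal_parameters U z n1 n2"
  shows "flat_normal_connection U z \<longleftrightarrow> (\<forall>p\<in>U. nu1 U z p + nu2 U z p = 0)"
proof -
  interpret orthogonal_chart U z
    using assms(1,2,5) by unfold_locales (auto simp: lorentz_surface_def principal_parameters_def)
  define H where "H = mean_curvature U z"
  define S where "S = sff_sum z"
  \<comment> \<open>\<open>det\<close> is, up to sign, the determinant in the normal plane for the basis given by the frame\<close>
  define det where "det p v w = ip22 v (n1 p) * ip22 w (n2 p) - ip22 w (n1 p) * ip22 v (n2 p)" for p v w
  note proportional = normal_vectors_proportional[OF _ assms(3)]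
  have HH: "ip22 (H p) (H p) \<noteq> 0" if "p \<in> U" for p
    using assms(4) that by (auto simp: general_type_def H_def)
  have H_normal: "H p \<in> normal_space z p" and S_normal: "S p \<in> normal_space z p" if "p \<in> U" for p
    using sff_in_normal_space[OF that]
    by (simp_all add: H_def S_def mean_curvature_eq[OF that] sff_sum_def normal_space_iff[OF that]
        ip22.add_left ip22.diff_left ip22.scaleR_left)
  have n12: "n1 p \<in> normal_space z p" "n2 p \<in> normal_space z p" if "p \<in> U" for p
    using assms(3) that by (auto simp: normal_frame_def)
  note coefs = second_derivative_coefficients[where n = n1, OF _ n12(1)]
    second_derivative_coefficients[where n = n2, OF _ n12(2)]
  have W: "coef_W z p \<noteq> 0" if "p \<in> U" for p
    using E_nz[OF that] G_nz[OF that] F_zero[OF that] by (simp add: coef_W_def)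
  have det_AC: "det p (sff z p (1, 0) (1, 0)) (sff z p (0, 1) (0, 1)) = 0" if "p \<in> U" for p
    using assms(5)[unfolded principal_parameters_def, rule_format, OF that] W[OF that] that
    by (simp add: principal_parameters_def coef_M_def Delta2_def coefs det_def)
  have det_SH: "det p (S p) (H p) = 0"
    and det_AH: "det p (sff z p (1, 0) (1, 0)) (H p) = 0"
    and det_CH: "det p (sff z p (0, 1) (0, 1)) (H p) = 0" if "p \<in> U" for p
    using det_AC[OF that] E_nz[OF that] G_nz[OF that]
    by (simp_all add: det_def S_def H_def mean_curvature_eq[OF that] sff_sum_def
        ip22.add_left ip22.diff_left ip22.scaleR_left field_simps)
  have S_zero_iff: "S p = 0 \<longleftrightarrow> ip22 (S p) (H p) = 0" if "p \<in> U" for p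
    using proportional[OF that S_normal[OF that] H_normal[OF that]] det_SH[OF that] HH[OF that]
    by (auto simp: det_def ip22.zero_left)
  have nu_iff: "nu1 U z p + nu2 U z p = 0 \<longleftrightarrow> S p = 0" if "p \<in> U" for p
    using HH[OF that]
    by (auto simp: nu_sum_eq[OF that] b_field_def ip22.scaleR_right eps_def S_zero_iff[OF that] sgn_if
        simp flip: S_def H_def)
  have flatD: "S p = 0" if flat: "flat_normal_connection U z" and p: "p \<in> U" for p
  proof (rule ccontr)
    assume "S p \<noteq> 0"
    then have SH: "ip22 (S p) (H p) \<noteq> 0" using S_zero_iff[OF p] by simp
    define A B C where "A = sff z p (1, 0) (1, 0)" "B = sff z p (0, 1) (1, 0)" "C = sff z p (0, 1) (0, 1)"
    note ABC = this
    have normal: "A \<in> normal_space z p" "B \<in> normal_space z p" "C \<in> normal_space z p"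
      by (simp_all add: ABC sff_in_normal_space[OF p])
    \<comment> \<open>test the curvature on a field that is a multiple of \<open>H\<close> at \<open>p\<close>: then the coefficient of \<open>B\<close> is
      not zero, and \<open>B\<close> is a multiple of \<open>S\<close>\<close>
    obtain \<xi> where \<xi>: "normal_field U z \<xi>" and \<xi>p: "\<xi> p = (coef_E z p * coef_G z p) *\<^sub>R H p"
      using normal_field_through_multiple[OF p H_normal[OF p]] .
    have "normal_curvature_tensor z (\<lambda>_. (1, 0)) (\<lambda>_. (0, 1)) \<xi> p = 0"
      using flat \<xi> p unfolding flat_normal_connection_def by (metis smooth_on_const)
    then have "(coef_E z p * coef_G z p) *\<^sub>R (ip22 (H p) B *\<^sub>R S p - ip22 (H p) (S p) *\<^sub>R B) = 0"
      by (simp add: normal_curvature_tensor_eq[OF p \<xi>] \<xi>p ip22.scaleR_left scaleR_right_diff_distrib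
          mult.assoc ABC S_def)
    then have "ip22 (S p) (H p) *\<^sub>R B = ip22 (H p) B *\<^sub>R S p"
      using E_nz[OF p] G_nz[OF p] by (simp add: ip22_commute[of "S p"])
    then have "ip22 (S p) (H p) * ip22 B n = ip22 (H p) B * ip22 (S p) n" for n
      by (metis ip22.scaleR_left real_scaleR_def)
    from this[of "n1 p"] this[of "n2 p"]
    have "ip22 (S p) (H p) * det p B (H p) = ip22 (H p) B * det p (S p) (H p)"
      unfolding det_def by algebra
    then have "det p B (H p) = 0" using det_SH[OF p] SH by simp
    then have H_multiple: "ip22 (H p) (H p) *\<^sub>R v = ip22 v (H p) *\<^sub>R H p" if "v \<in> {A, B, C}" for v
      using that det_AH[OF p] det_CH[OF p] normal proportional[OF p _ H_normal[OF p]]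
      by (auto simp: det_def simp flip: ABC)
    have "det p v w = 0" if "v \<in> {A, B, C}" "w \<in> {A, B, C}" for v w
    proof -
      have "ip22 (H p) (H p) * ip22 u n = ip22 u (H p) * ip22 (H p) n" if "u \<in> {A, B, C}" for u n
        using H_multiple[OF that] by (metis ip22.scaleR_left real_scaleR_def)
      from this[OF that(1), of "n1 p"] this[OF that(1), of "n2 p"]
        this[OF that(2), of "n1 p"] this[OF that(2), of "n2 p"]
      have "ip22 (H p) (H p) * ip22 (H p) (H p) * det p v w = 0"
        unfolding det_def by algebra
      then show ?thesis using HH[OF p] by simp
    qed
    then have "det p A B = 0" "det p A C = 0" "det p B C = 0" by blast+
    then have "coef_L z n1 n2 p = 0" "coef_M z n1 n2 p = 0" "coef_N z n1 n2 p = 0"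
      by (simp_all add: coef_L_def coef_M_def coef_N_def Delta1_def Delta2_def Delta3_def coefs p
          det_def ABC)
    then show False using assms(4) p by (simp add: general_type_def)
  qed
  have flatI: "flat_normal_connection U z" if S_zero: "\<And>p. p \<in> U \<Longrightarrow> S p = 0"
    unfolding flat_normal_connection_def
  proof (intro allI impI ballI, elim conjE)
    fix X Y :: "param \<Rightarrow> param" and \<xi> p
    assume XY: "smooth_on U X" "smooth_on U Y" and \<xi>: "normal_field U z \<xi>" and p: "p \<in> U"
    show "normal_curvature_tensor z X Y \<xi> p = 0"
      using S_zero[OF p]
      by (simp add: normal_curvature_tensor_eq[OF p \<xi>] smooth_on_imp_differentiable[OF _ p] XY
          ip22.zero_right S_def)
  qed
  show ?thesis using flatD flatI nu_iff by metis
qed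

end
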